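(* For all integers $m,n\ge 0$, the unary $m$-lighted $n$-shade right rotation digraph is the Hasse diagram of a lattice.
   Context: Write $[k]=\{1,\dots,k\}$. An $m$-lighted $n$-shade is a pair of sequences $S=(s_1,\dots,s_\ell)$ and $(c_1,\dots,c_\ell)$ of the same length $\ell\ge 0$, where each $s_i$ is a (possibly empty) tuple of positive integers, the sum of all entries of all the tuples is $n$, the $c_i$ are pairwise disjoint (possibly empty) subsets of $[m]$ with union $[m]$, and $c_i\neq\varnothing$ whenever $s_i$ is empty. It is read from top to bottom ("below" means larger index); an index $i$ with $c_i\neq\varnothing$ is a cut with labels $c_i$. It is unary if for each $i$, either $s_i$ is empty and $c_i$ is a singleton, or $c_i=\varnothing$ and $s_i$ has exactly one entry (a "singleton tuple"). The right rotation digraph on unary $m$-lighted $n$-shades has an edge from $\mathbb{S}$ to $\mathbb{S}'$ whenever $\mathbb{S}'$ is obtained from $\mathbb{S}$ by one of: (i) replacing a singleton tuple $(r)$ by two consecutive singleton tuples $(s),(t)$ with $r=s+t$, $s\ge1$, $t\ge1$; (ii) exchanging a singleton tuple with a cut immediately below it (so that the cut moves above it); (iii) exchanging the labels of two consecutive cuts with no singleton tuple in between, passing the small label above the large label (in $\mathbb{S}$ the larger label is above the smaller, in $\mathbb{S}'$ the smaller is above the larger). Edges are oriented from the smaller to the larger element of the order. *)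

theory Defs
  imports "HOL-Algebra.Lattice"
begin

text \<open>
  The two sequences \<open>(s\<^sub>1, \<dots>, s\<^sub>l)\<close> and \<open>(c\<^sub>1, \<dots>, c\<^sub>l)\<close> of the same length are
  zipped into one list of pairs \<open>(s\<^sub>i, c\<^sub>i)\<close>, listed from top to bottom.
\<close>

type_synonym shade = "(nat list \<times> nat set) list"

definition lighted_shade :: "nat \<Rightarrow> nat \<Rightarrow> shade \<Rightarrow> bool" where
  "lighted_shade m n S \<longleftrightarrow>
     (\<forall>(s, c) \<in> set S. (\<forall>k \<in> set s. 1 \<le> k) \<and> (s = [] \<longrightarrow> c \<noteq> {})) \<and>
     (\<Sum>(s, c) \<leftarrow> S. sum_list s) = n \<and>
     (\<forall>i < length S. \<forall>j < length S. i \<noteq> j \<longrightarrow> snd (S ! i) \<inter> snd (S ! j) = {}) \<and>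
     (\<Union>(s, c) \<in> set S. c) = {1..m}"

definition unary :: "shade \<Rightarrow> bool" where
  "unary S \<longleftrightarrow>
     (\<forall>(s, c) \<in> set S. (s = [] \<and> (\<exists>a. c = {a})) \<or> (c = {} \<and> (\<exists>r. s = [r])))"

definition unary_shades :: "nat \<Rightarrow> nat \<Rightarrow> shade set" where
  "unary_shades m n = {S. lighted_shade m n S \<and> unary S}"

inductive right_rotation :: "shade \<Rightarrow> shade \<Rightarrow> bool" where
  split_tuple: "r = s + t \<Longrightarrow> 1 \<le> s \<Longrightarrow> 1 \<le> t \<Longrightarrow>
    right_rotation (U @ [([r], {})] @ V) (U @ [([s], {}), ([t], {})] @ V)"
| raise_cut:
    "right_rotation (U @ [([r], {}), ([], {a})] @ V) (U @ [([], {a}), ([r], {})] @ V)"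
| exchange_labels: "a < b \<Longrightarrow>
    right_rotation (U @ [([], {b}), ([], {a})] @ V) (U @ [([], {a}), ([], {b})] @ V)"

definition right_rotation_edges :: "nat \<Rightarrow> nat \<Rightarrow> (shade \<times> shade) set" where
  "right_rotation_edges m n =
     {(S, S'). S \<in> unary_shades m n \<and> S' \<in> unary_shades m n \<and> right_rotation S S'}"

definition covered_by :: "'a gorder \<Rightarrow> 'a \<Rightarrow> 'a \<Rightarrow> bool" where
  "covered_by L x y \<longleftrightarrow>
     x \<in> carrier L \<and> y \<in> carrier L \<and> x \<sqsubset>\<^bsub>L\<^esub> y \<and>
     \<not> (\<exists>z \<in> carrier L. x \<sqsubset>\<^bsub>L\<^esub> z \<and> z \<sqsubset>\<^bsub>L\<^esub> y)"

definition is_Hasse_diagram :: "'a set \<Rightarrow> ('a \<times> 'a) set \<Rightarrow> 'a gorder \<Rightarrow> bool" where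
  "is_Hasse_diagram vs es L \<longleftrightarrow> carrier L = vs \<and> es = {(x, y). covered_by L x y}"

end

theory Submission
  imports Defs
begin

text \<open>
  A unary shade is determined by its set of prefix sums, by the sum of the entries above each
  cut, and by the order in which the labels occur. A right rotation enlarges the first,
  decreases the second, or turns an inversion of the third into a noninversion. Comparing the
  three data componentwise gives a partial order: if \<open>S < T\<close>, then some rotation of \<open>S\<close> is still
  below \<open>T\<close>, and no shade lies strictly between the two ends of a rotation. Joins are built as
  in the weak order on permutations; meets exist since the poset is finite and has a bottom.
\<close>

section \<open>The three data of a shade\<close>

definition labels :: "shade \<Rightarrow> nat set" where
  "labels S = (\<Union>x\<in>set S. snd x)"

definition weight :: "shade \<Rightarrow> nat" where
  "weight S = (\<Sum>(s, c) \<leftarrow> S. sum_list s)"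

text \<open>Merges the unary condition with positivity of entries and nonemptiness of cuts into one
  itemwise condition, which distributes over \<open>#\<close> and \<open>@\<close>.\<close>

definition unary_items :: "shade \<Rightarrow> bool" where
  "unary_items S \<longleftrightarrow> (\<forall>x\<in>set S. (\<exists>r\<ge>1. x = ([r], {})) \<or> (\<exists>a. x = ([], {a})))"

fun disjoint_labels :: "shade \<Rightarrow> bool" where
  "disjoint_labels [] \<longleftrightarrow> True"
| "disjoint_labels (x # S) \<longleftrightarrow> snd x \<inter> labels S = {} \<and> disjoint_labels S"

text \<open>The offset \<open>k\<close> is the sum of what has already been read, so inductions can
  pass to the tail; a whole shade is read with offset 0.\<close>

fun prefix_sums :: "nat \<Rightarrow> shade \<Rightarrow> nat set" where
  "prefix_sums k [] = {k}"
| "prefix_sums k (x # S) = insert k (prefix_sums (k + sum_list (fst x)) S)"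

text \<open>The value on a label that does not occur is junk.\<close>

fun pos :: "nat \<Rightarrow> shade \<Rightarrow> nat \<Rightarrow> nat" where
  "pos k [] a = k"
| "pos k (x # S) a = (if a \<in> snd x then k else pos (k + sum_list (fst x)) S a)"

fun above :: "shade \<Rightarrow> nat \<Rightarrow> nat \<Rightarrow> bool" where
  "above [] a b \<longleftrightarrow> False"
| "above (x # S) a b \<longleftrightarrow> a \<in> snd x \<and> b \<in> labels S \<or> above S a b"

lemma labels_simps [simp]:
  "labels [] = {}" "labels (x # S) = snd x \<union> labels S"
  "labels (S @ T) = labels S \<union> labels T"
  by (auto simp: labels_def)

lemma weight_simps [simp]:
  "weight [] = 0" "weight (x # S) = sum_list (fst x) + weight S"
  "weight (S @ T) = weight S + weight T"
  by (auto simp: weight_def split: prod.splits)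

lemma unary_items_simps [simp]:
  "unary_items []"
  "unary_items (x # S) \<longleftrightarrow>
    ((\<exists>r\<ge>1. x = ([r], {})) \<or> (\<exists>a. x = ([], {a}))) \<and> unary_items S"
  "unary_items (S @ T) \<longleftrightarrow> unary_items S \<and> unary_items T"
  by (auto simp: unary_items_def)

lemma disjoint_labels_append [simp]:
  "disjoint_labels (S @ T) \<longleftrightarrow>
    disjoint_labels S \<and> disjoint_labels T \<and> labels S \<inter> labels T = {}"
  by (induction S) auto

lemma prefix_sums_base [simp]: "k \<in> prefix_sums k S"
  by (cases S) auto

lemma prefix_sums_append [simp]:
  "prefix_sums k (S @ T) = prefix_sums k S \<union> prefix_sums (k + weight S) T"
  by (induction S arbitrary: k) (auto simp: add.assoc)

lemma prefix_sums_end [simp]: "k + weight S \<in> prefix_sums k S"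
  by (induction S arbitrary: k) (auto simp flip: add.assoc)

lemma prefix_sums_bounds: "x \<in> prefix_sums k S \<Longrightarrow> k \<le> x \<and> x \<le> k + weight S"
  by (induction S arbitrary: k) fastforce+

lemma pos_append [simp]:
  "pos k (S @ T) a = (if a \<in> labels S then pos k S a else pos (k + weight S) T a)"
  by (induction S arbitrary: k) (auto simp: add.assoc)

lemma above_append [simp]:
  "above (S @ T) a b \<longleftrightarrow> above S a b \<or> above T a b \<or> a \<in> labels S \<and> b \<in> labels T"
  by (induction S) auto

lemma above_labels: "above S a b \<Longrightarrow> a \<in> labels S \<and> b \<in> labels S"
  by (induction S) auto

text \<open>Each unary item carries at most one label, so distinct labels sit in different items.
  With asymmetry and transitivity, \<open>above\<close> becomes a strict total order on the
  labels.\<close>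

lemma above_total:
  "unary_items S \<Longrightarrow> a \<in> labels S \<Longrightarrow> b \<in> labels S \<Longrightarrow> a \<noteq> b \<Longrightarrow> above S a b \<or> above S b a"
  by (induction S) auto

lemma above_asym: "disjoint_labels S \<Longrightarrow> above S a b \<Longrightarrow> \<not> above S b a"
  by (induction S) (auto dest: above_labels)

lemma above_irrefl: "disjoint_labels S \<Longrightarrow> \<not> above S a a"
  using above_asym by blast

lemma above_trans: "disjoint_labels S \<Longrightarrow> above S a b \<Longrightarrow> above S b c \<Longrightarrow> above S a c"
  by (induction S) (auto dest: above_labels)

lemma pos_prefix_sums: "a \<in> labels S \<Longrightarrow> pos k S a \<in> prefix_sums k S"
  by (induction S arbitrary: k) auto

lemma pos_bounds: "a \<in> labels S \<Longrightarrow> k \<le> pos k S a \<and> pos k S a \<le> k + weight S"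
  using pos_prefix_sums prefix_sums_bounds by blast

lemma pos_mono: "disjoint_labels S \<Longrightarrow> above S a b \<Longrightarrow> pos k S a \<le> pos k S b"
proof (induction S arbitrary: k)
  case (Cons x S)
  then show ?case
    using pos_bounds[of b S "k + sum_list (fst x)"] above_labels[of S a b] by auto
qed simp

lemma pos_less_above:
  assumes "unary_items S" "disjoint_labels S" "a \<in> labels S" "b \<in> labels S"
    and "pos k S a < pos k S b"
  shows "above S a b"
  using assms above_total[of S a b] pos_mono[of S b a k] by fastforce

section \<open>Reconstruction of a shade from its data\<close>

text \<open>The data reveal the top item of a nonempty shade: if no label has coordinate
  \<open>k\<close>, it is a tuple reaching to the next prefix sum; otherwise it is the cut whose
  label is above all others. Then induct on the rest.\<close>

lemma shade_eqI:
  assumes "unary_items S" "disjoint_labels S" "unary_items T" "disjoint_labels T"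
    and "labels S = labels T" "prefix_sums k S = prefix_sums k T"
    and "\<And>a. a \<in> labels S \<Longrightarrow> pos k S a = pos k T a"
    and "\<And>a b. above S a b \<Longrightarrow> above T a b"
  shows "S = T"
  using assms
proof (induction S arbitrary: k T)
  case Nil
  show ?case
  proof (cases T)
    case (Cons y T')
    then have "prefix_sums (k + sum_list (fst y)) T' \<subseteq> {k}"
      using Nil.prems(6) by auto
    then have "k + sum_list (fst y) = k"
      using prefix_sums_base by blast
    then show ?thesis
      using Nil.prems(3,5) Cons by auto
  qed simp
next
  case (Cons x S)
  have base: "k' \<notin> prefix_sums (k' + r) V" if "r \<ge> 1" for k' r V
    using that prefix_sums_bounds by fastforce
  have "T \<noteq> []"
  proof
    assume T: "T = []"
    then obtain r where r: "r \<ge> 1" "x = ([r], {})"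
      using Cons.prems(1,5) by auto
    then have "prefix_sums (k + r) S \<subseteq> {k}"
      using T Cons.prems(6) by auto
    then have "k + r \<in> {k}"
      using prefix_sums_base by (rule subsetD)
    then show False
      using r(1) by simp
  qed
  then obtain y T' where T: "T = y # T'"
    by (cases T) auto
  consider r where "r \<ge> 1" "x = ([r], {})" | a where "x = ([], {a})"
    using Cons.prems by auto
  then show ?case
  proof cases
    case (1 r)
    \<comment> \<open>A tuple on top pushes every label strictly beyond \<open>k\<close>, so
      \<open>T\<close> cannot start with a cut.\<close>
    have "k < pos k (x # S) a" if "a \<in> labels (x # S)" for a
      using that 1 pos_bounds[of a S "k + r"] by auto
    then have "snd y = {}"
      using Cons.prems(5,7) T by fastforce
    then obtain q where q: "q \<ge> 1" "y = ([q], {})"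
      using Cons.prems(3) T by auto
    have "insert k (prefix_sums (k + r) S) = insert k (prefix_sums (k + q) T')"
      using Cons.prems(6) T 1 q by simp
    then have eq: "prefix_sums (k + r) S = prefix_sums (k + q) T'"
      using base[OF 1(1)] base[OF q(1)] by (metis insert_ident)
    then have "k + r = k + q"
      using prefix_sums_bounds[of "k + r" "k + q" T'] prefix_sums_bounds[of "k + q" "k + r" S]
        prefix_sums_base[of "k + r" S] prefix_sums_base[of "k + q" T'] by simp
    then have "r = q" by simp
    moreover have "S = T'"
      by (rule Cons.IH[of _ "k + r"]) (use Cons.prems 1 q T eq \<open>r = q\<close> in auto)
    ultimately show ?thesis using 1 q T by simp
  next
    case (2 a)
    have a: "pos k T a = k" "a \<in> labels T"
      using Cons.prems(5) Cons.prems(7)[of a, symmetric] 2 by auto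
    have "\<exists>b. y = ([], {b})"
    proof (rule ccontr)
      assume "\<nexists>b. y = ([], {b})"
      then obtain q where "q \<ge> 1" "y = ([q], {})"
        using Cons.prems(3) T by auto
      then show False
        using a T pos_bounds[of a T' "k + q"] by auto
    qed
    then obtain b where b: "y = ([], {b})" by auto
    \<comment> \<open>If the top labels differed, \<open>b\<close> would lie below \<open>a\<close>
      in \<open>S\<close>, hence also in \<open>T\<close>, although \<open>T\<close> starts with
      \<open>b\<close>.\<close>
    have "a = b"
    proof (rule ccontr)
      assume "a \<noteq> b"
      have "b \<in> labels (x # S)" using Cons.prems(5) T b by simp
      then have "above T a b" using Cons.prems(8) 2 \<open>a \<noteq> b\<close> by auto
      moreover have "above T b a" using a T b \<open>a \<noteq> b\<close> by auto
      ultimately show False using above_asym Cons.prems(4) by blast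
    qed
    have labels: "labels S = labels T'"
      using Cons.prems(2,4,5) T b 2 \<open>a = b\<close> by auto
    have "S = T'"
    proof (rule Cons.IH[of _ k])
      show "prefix_sums k S = prefix_sums k T'"
        using Cons.prems(6) T b 2 by (simp add: insert_absorb)
      show "pos k S c = pos k T' c" if "c \<in> labels S" for c
        using Cons.prems(7)[of c] Cons.prems(2) T b 2 \<open>a = b\<close> that by (auto split: if_splits)
      show "above T' c d" if "above S c d" for c d
        using Cons.prems(8)[of c d] Cons.prems(2) T b 2 \<open>a = b\<close> that
        by (auto dest: above_labels)
    qed (use Cons.prems T labels in auto)
    then show ?thesis using 2 b T \<open>a = b\<close> by simp
  qed
qed

section \<open>Shades with fixed parameters and their order\<close>

lemma disjoint_labels_iff:
  "disjoint_labels S \<longleftrightarrow>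
    (\<forall>i<length S. \<forall>j<length S. i \<noteq> j \<longrightarrow> snd (S ! i) \<inter> snd (S ! j) = {})"
proof (induction S)
  case (Cons x S)
  have "snd x \<inter> labels S = {} \<longleftrightarrow> (\<forall>y\<in>set S. snd x \<inter> snd y = {})"
    unfolding labels_def by blast
  also have "\<dots> \<longleftrightarrow> (\<forall>j<length S. snd x \<inter> snd (S ! j) = {})"
    by (rule all_set_conv_all_nth)
  finally have "snd x \<inter> labels S = {} \<longleftrightarrow> (\<forall>j<length S. snd x \<inter> snd (S ! j) = {})" .
  then show ?case
    unfolding length_Cons All_less_Suc2 by (simp add: Cons.IH Int_commute) blast
qed simp

lemma unary_shades_iff:
  "S \<in> unary_shades m n \<longleftrightarrow>
    unary_items S \<and> disjoint_labels S \<and> labels S = {1..m} \<and> weight S = n"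
proof -
  have "(\<Union>(s, c)\<in>set S. c) = labels S"
    by (auto simp: labels_def)
  moreover have "unary S \<and> (\<forall>(s, c)\<in>set S. (\<forall>k\<in>set s. 1 \<le> k) \<and> (s = [] \<longrightarrow> c \<noteq> {}))
      \<longleftrightarrow> unary_items S"
    unfolding unary_def unary_items_def by fastforce
  ultimately show ?thesis
    unfolding unary_shades_def lighted_shade_def disjoint_labels_iff weight_def by auto
qed

text \<open>Restricted to \<open>a < b\<close>, the third clause is inclusion of noninversion sets,
  that is, the weak order on label permutations. The second clause reverses the inequality because
  raising a cut lowers its coordinate.\<close>

definition shade_le :: "shade \<Rightarrow> shade \<Rightarrow> bool" where
  "shade_le S T \<longleftrightarrow> prefix_sums 0 S \<subseteq> prefix_sums 0 T \<and>
    (\<forall>a\<in>labels S. pos 0 T a \<le> pos 0 S a) \<and>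
    (\<forall>a b. a < b \<longrightarrow> above S a b \<longrightarrow> above T a b)"

lemma shade_le_refl: "shade_le S S"
  by (simp add: shade_le_def)

lemma shade_le_trans:
  "labels S = labels T \<Longrightarrow> shade_le S T \<Longrightarrow> shade_le T U \<Longrightarrow> shade_le S U"
  unfolding shade_le_def by (metis order_trans)

text \<open>Pairs with \<open>a < b\<close> suffice, since each shade orders two distinct labels in
  exactly one way.\<close>

lemma unary_shades_eqI:
  assumes S: "S \<in> unary_shades m n" and T: "T \<in> unary_shades m n"
    and "prefix_sums 0 S = prefix_sums 0 T"
    and "\<And>a. a \<in> {1..m} \<Longrightarrow> pos 0 S a = pos 0 T a"
    and less: "\<And>a b. a < b \<Longrightarrow> above S a b \<longleftrightarrow> above T a b"
  shows "S = T"
proof (rule shade_eqI[of _ _ 0])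
  fix a b assume ab: "above S a b"
  then have "a \<noteq> b" "a \<in> {1..m}" "b \<in> {1..m}"
    using S above_irrefl above_labels unfolding unary_shades_iff by blast+
  then show "above T a b"
    using ab less[of a b] less[of b a] S T above_asym above_total
    unfolding unary_shades_iff by (metis linorder_neqE_nat)
qed (use assms in \<open>auto simp: unary_shades_iff\<close>)

lemma shade_le_antisym:
  assumes "S \<in> unary_shades m n" "T \<in> unary_shades m n" "shade_le S T" "shade_le T S"
  shows "S = T"
proof (rule unary_shades_eqI[OF assms(1,2)])
  have labels: "labels S = {1..m}" "labels T = {1..m}"
    using assms(1,2) by (simp_all add: unary_shades_iff)
  note le = assms(3,4)[unfolded shade_le_def labels]
  show "prefix_sums 0 S = prefix_sums 0 T" using le by blast
  show "pos 0 S a = pos 0 T a" if "a \<in> {1..m}" for a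
    using le that by (simp add: order.antisym)
  show "above S a b \<longleftrightarrow> above T a b" if "a < b" for a b
    using le that by blast
qed

lemma unary_shades_finite: "finite (unary_shades m n)"
proof -
  let ?A = "(\<lambda>r. ([r], {})) ` {..n} \<union> (\<lambda>a. ([], {a})) ` {1..m}"
  \<comment> \<open>Every item uses up at least one unit of weight or one new label.\<close>
  have "length S \<le> weight S + card (labels S)" if "unary_items S" "disjoint_labels S" for S
    using that
  proof (induction S)
    case (Cons x S)
    have "finite (labels S)"
      using Cons.prems unfolding labels_def unary_items_def by fastforce
    then show ?case
      using Cons by auto
  qed simp
  then have "length S \<le> n + m" if "S \<in> unary_shades m n" for S
    using that by (fastforce simp: unary_shades_iff)
  moreover have "set S \<subseteq> ?A" if "unary_items S" "labels S \<subseteq> {1..m}" "weight S \<le> n" for S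
    using that by (induction S) auto
  then have "set S \<subseteq> ?A" if "S \<in> unary_shades m n" for S
    using that by (simp add: unary_shades_iff)
  ultimately have "unary_shades m n \<subseteq> {S. set S \<subseteq> ?A \<and> length S \<le> n + m}"
    by blast
  then show ?thesis
    by (rule finite_subset) (simp add: finite_lists_length_le)
qed

section \<open>Effect of rotations on the data, and the covering property\<close>

lemma split_tuple_data:
  assumes "S = U @ [([s + t], {})] @ V" "S' = U @ [([s], {}), ([t], {})] @ V"
  shows "prefix_sums 0 S' = insert (weight U + s) (prefix_sums 0 S)"
    and "pos 0 S' c = pos 0 S c" and "above S' c d \<longleftrightarrow> above S c d"
  by (auto simp: assms add.assoc)

lemma raise_cut_data:
  assumes "S = U @ [([r], {}), ([], {a})] @ V" "S' = U @ [([], {a}), ([r], {})] @ V"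
    and "a \<notin> labels U"
  shows "prefix_sums 0 S' = prefix_sums 0 S"
    and "pos 0 S' c = (if c = a then weight U else pos 0 S c)"
    and "pos 0 S a = weight U + r"
    and "above S' c d \<longleftrightarrow> above S c d"
  using assms(3) by (auto simp: assms(1,2))

text \<open>The two cuts are adjacent, so no third label changes side. Disjointness excludes other
  occurrences of \<open>a\<close> and \<open>b\<close> that would still put \<open>b\<close> above
  \<open>a\<close>.\<close>

lemma exchange_labels_data:
  assumes "S = U @ [([], {b}), ([], {a})] @ V" "S' = U @ [([], {a}), ([], {b})] @ V"
    and "disjoint_labels S"
  shows "prefix_sums 0 S' = prefix_sums 0 S"
    and "pos 0 S' c = pos 0 S c"
    and "above S' c d \<longleftrightarrow> above S c d \<and> (c, d) \<noteq> (b, a) \<or> (c, d) = (a, b)"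
  using assms(3) by (auto simp: assms(1,2) dest: above_labels)

text \<open>No prefix sum falls strictly inside a tuple, so a cut jumping over it has no
  intermediate coordinate to stop at.\<close>

lemma raise_cut_adjacent:
  assumes "x \<in> prefix_sums 0 (U @ [([r], {}), ([], {a})] @ V)"
    and "weight U \<le> x" "x \<le> weight U + r"
  shows "x = weight U \<or> x = weight U + r"
  using assms prefix_sums_bounds[of x 0 U] prefix_sums_bounds[of x "weight U + r" V] by auto

lemma right_rotation_le:
  assumes "right_rotation S S'" "S \<in> unary_shades m n"
  shows "shade_le S S'" "S \<noteq> S'"
  using assms
proof (induction rule: right_rotation.induct)
  case (split_tuple r s t U V)
  note data = split_tuple_data[OF refl refl, of U s t V]
  {
    case 1
    show ?case using split_tuple data by (auto simp: shade_le_def)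
  next
    case 2
    show ?case by simp
  }
next
  case (raise_cut U r a V)
  {
    case 1
    then have "a \<notin> labels U" by (simp add: unary_shades_iff)
    note data = raise_cut_data[OF refl refl this, of r V]
    show ?case using data by (auto simp: shade_le_def simp del: pos_append above_append)
  next
    case 2
    show ?case by simp
  }
next
  case (exchange_labels a b U V)
  {
    case 1
    then have "disjoint_labels (U @ [([], {b}), ([], {a})] @ V)" by (simp only: unary_shades_iff)
    note data = exchange_labels_data[OF refl refl this]
    show ?case using data exchange_labels
      by (auto simp: shade_le_def simp del: pos_append above_append)
  next
    case 2
    show ?case using exchange_labels by simp
  }
qed

text \<open>A rotation changes one datum by one indivisible step. The other data of \<open>Z\<close>
  are squeezed between equal ones, and the changed datum has only its two end values left.\<close>

lemma right_rotation_no_between: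
  assumes rot: "right_rotation S S'" and S: "S \<in> unary_shades m n" "S' \<in> unary_shades m n"
    and Z: "Z \<in> unary_shades m n" "shade_le S Z" "shade_le Z S'"
  shows "Z = S \<or> Z = S'"
proof -
  have labels: "labels S = {1..m}" "labels S' = {1..m}" "labels Z = {1..m}"
    and disj: "disjoint_labels S"
    using S Z(1) by (auto simp: unary_shades_iff)
  have pos: "pos 0 Z c \<le> pos 0 S c" "pos 0 S' c \<le> pos 0 Z c" if "c \<in> {1..m}" for c
    using Z that by (auto simp: shade_le_def labels)
  have P: "prefix_sums 0 S \<subseteq> prefix_sums 0 Z" "prefix_sums 0 Z \<subseteq> prefix_sums 0 S'"
    and above: "\<And>c d. c < d \<Longrightarrow> above S c d \<Longrightarrow> above Z c d"
      "\<And>c d. c < d \<Longrightarrow> above Z c d \<Longrightarrow> above S' c d"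
    using Z by (auto simp: shade_le_def)
  note eqI = unary_shades_eqI[OF Z(1) S(1)] unary_shades_eqI[OF Z(1) S(2)]
  from rot show ?thesis
  proof cases
    case (split_tuple r s t U V)
    note data = split_tuple_data[OF split_tuple(1)[unfolded split_tuple(3)] split_tuple(2)]
    have "prefix_sums 0 Z = prefix_sums 0 S \<or> prefix_sums 0 Z = prefix_sums 0 S'"
      using P unfolding data(1) by blast
    then show ?thesis
      using eqI above pos data(2,3) by (metis le_antisym)
  next
    case (raise_cut U r a V)
    have "a \<notin> labels U" "a \<in> {1..m}"
      using disj labels(1) raise_cut by auto
    note data = raise_cut_data[OF raise_cut this(1)]
    have PZ: "prefix_sums 0 Z = prefix_sums 0 S"
      using P data(1) by auto
    \<comment> \<open>\<open>Z\<close> has the prefix sums of \<open>S\<close>, so only the two ends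
      of the tuple \<open>([r], {})\<close> are available as coordinate of \<open>a\<close>.\<close>
    have "pos 0 Z a \<in> prefix_sums 0 S"
      using pos_prefix_sums[of a Z 0] \<open>a \<in> {1..m}\<close> labels PZ by simp
    moreover have "weight U \<le> pos 0 Z a" "pos 0 Z a \<le> weight U + r"
      using pos[OF \<open>a \<in> {1..m}\<close>] data(2)[of a] data(3) by auto
    ultimately have "pos 0 Z a = pos 0 S a \<or> pos 0 Z a = pos 0 S' a"
      using raise_cut_adjacent data(2)[of a] data(3) unfolding raise_cut(1) by fastforce
    moreover have "pos 0 Z c = pos 0 S c \<and> pos 0 Z c = pos 0 S' c" if "c \<noteq> a" "c \<in> {1..m}" for c
      using pos[OF that(2)] data(2)[of c] that(1) by simp
    ultimately show ?thesis
      using eqI above PZ data(1,4) by metis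
  next
    case (exchange_labels a b U V)
    note data = exchange_labels_data[OF exchange_labels(1,2) disj]
    have PZ: "prefix_sums 0 Z = prefix_sums 0 S"
      using P data(1) by auto
    have posZ: "pos 0 Z c = pos 0 S c" if "c \<in> {1..m}" for c
      using pos[OF that] data(2) by simp
    have "above Z c d \<longleftrightarrow> above S c d" if "c < d" "(c, d) \<noteq> (a, b)" for c d
      using above[OF that(1)] data(3)[of c d] that exchange_labels(3) by auto
    moreover have "above S' c d \<longleftrightarrow> above S c d" if "c < d" "(c, d) \<noteq> (a, b)" for c d
      using data(3)[of c d] that exchange_labels(3) by auto
    moreover have "\<not> above S a b" "above S' a b"
      using above_asym[OF disj, of a b] unfolding exchange_labels(1,2) by auto
    ultimately show ?thesis
      using eqI PZ posZ data(1,2) by (cases "above Z a b") (metis prod.inject)+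
  qed
qed

section \<open>Rotations that stay below a larger shade\<close>

text \<open>A value in range that is not a prefix sum falls strictly inside one tuple, which can be
  split there.\<close>

lemma exists_split:
  assumes "unary_items S" "k \<le> x" "x \<le> k + weight S" "x \<notin> prefix_sums k S"
  shows "\<exists>U s t V. S = U @ [([s + t], {})] @ V \<and> 1 \<le> s \<and> 1 \<le> t \<and> x = k + weight U + s"
  using assms
proof (induction S arbitrary: k)
  case (Cons y S)
  show ?case
  proof (cases "x < k + sum_list (fst y)")
    case True
    then obtain r where "y = ([r], {})"
      using Cons.prems by auto
    moreover from this have "k < x" "x < k + r"
      using Cons.prems True by (auto simp: less_le)
    ultimately have "y # S = [] @ [([(x - k) + (k + r - x)], {})] @ S \<and> 1 \<le> x - k \<and>
        1 \<le> k + r - x \<and> x = k + weight [] + (x - k)"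
      by auto
    then show ?thesis by blast
  next
    case False
    then obtain U s t V where "S = U @ [([s + t], {})] @ V" "1 \<le> s" "1 \<le> t"
      "x = k + sum_list (fst y) + weight U + s"
      using Cons.IH[of "k + sum_list (fst y)"] Cons.prems by auto
    then have "y # S = (y # U) @ [([s + t], {})] @ V \<and> 1 \<le> s \<and> 1 \<le> t \<and>
        x = k + weight (y # U) + s"
      by simp
    then show ?thesis using \<open>1 \<le> s\<close> by blast
  qed
qed simp

text \<open>Read from top to bottom, \<open>S\<close> agrees with \<open>T\<close> as long as no raising or exchange in \<open>S\<close>
  leads to a shade that is still below \<open>T\<close>.\<close>

lemma stuck_agrees:
  assumes S: "S \<in> unary_shades m n" and T: "T \<in> unary_shades m n" and le: "shade_le S T"
    and no_raise: "\<And>U r a V. S = U @ [([r], {}), ([], {a})] @ V \<Longrightarrow> pos 0 S a \<le> pos 0 T a"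
    and no_exchange: "\<And>U a b V. S = U @ [([], {b}), ([], {a})] @ V \<Longrightarrow> a < b \<Longrightarrow> above T b a"
    and "S = U @ V"
  shows "\<forall>a\<in>labels U. pos 0 S a = pos 0 T a \<and> (\<forall>b. above U b a \<longrightarrow> above T b a)"
  using assms(6)
proof (induction U arbitrary: V rule: rev_induct)
  case (snoc x U)
  have dS: "disjoint_labels S" and dT: "disjoint_labels T" and uT: "unary_items T"
    and uS: "unary_items S"
    and labels: "labels S = {1..m}" "labels T = {1..m}"
    using S T by (auto simp: unary_shades_iff)
  have IH: "pos 0 S a = pos 0 T a" "above U b a \<Longrightarrow> above T b a" if "a \<in> labels U" for a b
    using snoc.IH[of "x # V"] snoc.prems that by auto
  have posT: "pos 0 T a \<le> pos 0 S a" if "a \<in> labels S" for a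
    using le that by (auto simp: shade_le_def)
  consider r where "x = ([r], {})" | a where "x = ([], {a})"
    using uS snoc.prems by auto
  then show ?case
  proof cases
    case 1
    then show ?thesis using IH by auto
  next
    case (2 a)
    have a: "a \<in> labels S" "a \<notin> labels U" and U: "labels U \<subseteq> labels S" "disjoint_labels U"
      using snoc.prems 2 dS by auto
    have posa: "pos 0 S a = weight U"
      using snoc.prems 2 a by simp
    \<comment> \<open>The opposite bound on the coordinate is \<open>posT\<close>; this claim is
      read off from the item directly above the cut.\<close>
    have "pos 0 S a \<le> pos 0 T a \<and> (\<forall>b\<in>labels U. above T b a)"
    proof (cases U rule: rev_cases)
      case Nil
      then show ?thesis using posa by simp
    next
      case (snoc U' y)
      note U_eq = this
      consider r where "r \<ge> 1" "y = ([r], {})" | b where "y = ([], {b})"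
        using uS snoc.prems snoc by auto
      then show ?thesis
      proof cases
        case (1 r)
        then have le_a: "pos 0 S a \<le> pos 0 T a"
          using no_raise[of U' r a V] snoc.prems U_eq 2 by simp
        \<comment> \<open>As \<open>r \<ge> 1\<close>, every label of \<open>U\<close> has a
          strictly smaller coordinate than \<open>a\<close>, which fixes the order in
          \<open>T\<close>.\<close>
        have "above T b a" if b: "b \<in> labels U" for b
        proof (rule pos_less_above[OF uT dT, of _ _ 0])
          have "pos 0 S b \<le> weight U'"
            using b snoc.prems U_eq 1 pos_bounds[of b U' 0] by auto
          then have "pos 0 S b < pos 0 S a"
            using posa U_eq 1 by simp
          then show "pos 0 T b < pos 0 T a"
            using le_a IH(1)[OF b] by simp
        qed (use a b U labels in auto)
        then show ?thesis using le_a by blast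
      next
        case (2 b)
        have b: "b \<in> labels U" "b \<noteq> a" using 2 U_eq a by auto
        \<comment> \<open>For the adjacent cuts \<open>b\<close> and \<open>a\<close>, an inversion
          persists in \<open>T\<close> because the exchange is blocked, and a noninversion persists
          by \<open>shade_le\<close>.\<close>
        have ba: "above T b a"
        proof (cases "a < b")
          case True
          then show ?thesis
            using no_exchange[of U' b a V] snoc.prems U_eq \<open>x = ([], {a})\<close> 2 by simp
        next
          case False
          moreover have "above S b a"
            using snoc.prems U_eq \<open>x = ([], {a})\<close> 2 by simp
          ultimately show ?thesis
            using le b(2) by (auto simp: shade_le_def)
        qed
        \<comment> \<open>No tuple separates the two cuts, so the bound passes from \<open>b\<close>
          to \<open>a\<close>. Other labels are above \<open>a\<close> by transitivity through
          \<open>b\<close>.\<close>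
        have "pos 0 S b = weight U"
          using snoc.prems U_eq 2 dS by auto
        then have "pos 0 S a \<le> pos 0 T a"
          using pos_mono[OF dT ba, of 0] IH(1)[OF b(1)] posa by simp
        moreover have "above T c a" if "c \<in> labels U" for c
        proof (cases "c = b")
          case False
          then have "above U c b"
            using that U_eq 2 by auto
          then show ?thesis
            using IH(2)[OF b(1)] ba above_trans[OF dT] by blast
        qed (use ba in simp)
        ultimately show ?thesis by blast
      qed
    qed
    then show ?thesis
      using posT[OF a(1)] IH 2 a(2) by (auto dest: above_labels)
  qed
qed simp

text \<open>Prefix sums are repaired first, by splitting at a value that \<open>S\<close> lacks.
  Once they agree, some raise or exchange stays below \<open>T\<close>, since otherwise
  \<open>stuck_agrees\<close> for all of \<open>S\<close> gives \<open>S = T\<close>.\<close>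

lemma exists_right_rotation:
  assumes S: "S \<in> unary_shades m n" and T: "T \<in> unary_shades m n"
    and le: "shade_le S T" and "S \<noteq> T"
  shows "\<exists>S'\<in>unary_shades m n. right_rotation S S' \<and> shade_le S' T"
proof (cases "prefix_sums 0 T \<subseteq> prefix_sums 0 S")
  case False
  then obtain x where x: "x \<in> prefix_sums 0 T" "x \<notin> prefix_sums 0 S" by blast
  then have "x \<le> 0 + weight S"
    using prefix_sums_bounds[of x 0 T] S T by (simp add: unary_shades_iff)
  then obtain U s t V where U: "S = U @ [([s + t], {})] @ V" "1 \<le> s" "1 \<le> t" "x = weight U + s"
    using exists_split[of S 0 x] S x by (auto simp: unary_shades_iff)
  define S' where "S' = U @ [([s], {}), ([t], {})] @ V"
  note data = split_tuple_data[OF U(1) S'_def]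
  have S': "S' \<in> unary_shades m n"
    using S U by (auto simp: unary_shades_iff S'_def)
  moreover have "right_rotation S S'"
    unfolding U(1) S'_def using U by (intro right_rotation.split_tuple) auto
  moreover have "labels S = labels S'"
    using S S' by (simp add: unary_shades_iff)
  then have "shade_le S' T"
    using le x U(4) data by (auto simp: shade_le_def)
  ultimately show ?thesis by blast
next
  case True
  then have P: "prefix_sums 0 S = prefix_sums 0 T"
    using le by (auto simp: shade_le_def)
  have dS: "disjoint_labels S" and labels: "labels S = {1..m}" "labels T = {1..m}"
    and dT: "disjoint_labels T"
    using S T by (auto simp: unary_shades_iff)
  show ?thesis
  proof (rule ccontr)
    assume not: "\<not> ?thesis"
    have no_raise: "pos 0 S a \<le> pos 0 T a" if U: "S = U @ [([r], {}), ([], {a})] @ V" for U r a V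
    proof (rule ccontr)
      assume less: "\<not> pos 0 S a \<le> pos 0 T a"
      define S' where "S' = U @ [([], {a}), ([r], {})] @ V"
      have a: "a \<notin> labels U" "a \<in> {1..m}"
        using dS labels U by auto
      note data = raise_cut_data[OF U S'_def a(1)]
      have S': "S' \<in> unary_shades m n"
        using S U by (auto simp: unary_shades_iff S'_def)
      \<comment> \<open>A prefix sum smaller than \<open>weight U + r\<close> is at most
        \<open>weight U\<close>, so raising \<open>a\<close> over one tuple does not overshoot
        \<open>T\<close>.\<close>
      have "pos 0 T a \<in> prefix_sums 0 S"
        unfolding P using pos_prefix_sums a labels by blast
      then have "pos 0 T a \<le> weight U"
        using raise_cut_adjacent[of "pos 0 T a" U r a V] less data(3) U by fastforce
      then have "shade_le S' T"
        using le labels S' data(1,2,4) by (simp add: shade_le_def unary_shades_iff)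
      moreover have "right_rotation S S'"
        unfolding U S'_def by (rule right_rotation.raise_cut)
      ultimately show False using not S' by blast
    qed
    have no_exchange: "above T b a"
      if U: "S = U @ [([], {b}), ([], {a})] @ V" and "a < b" for U a b V
    proof (rule ccontr)
      assume no: "\<not> above T b a"
      define S' where "S' = U @ [([], {a}), ([], {b})] @ V"
      note data = exchange_labels_data[OF U S'_def dS]
      have S': "S' \<in> unary_shades m n"
        using S U by (auto simp: unary_shades_iff S'_def)
      have "a \<in> labels T" "b \<in> labels T"
        using labels U by auto
      \<comment> \<open>The exchange adds only the noninversion \<open>(a, b)\<close>, which
        \<open>T\<close> has too because its order is total.\<close>
      then have "above T a b"
        using no above_total[of T a b] T \<open>a < b\<close> by (auto simp: unary_shades_iff)
      then have "shade_le S' T"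
        using le labels S' data by (auto simp: shade_le_def unary_shades_iff)
      moreover have "right_rotation S S'"
        unfolding U S'_def using \<open>a < b\<close> by (rule right_rotation.exchange_labels)
      ultimately show False using not S' by blast
    qed
    have agree: "\<forall>a\<in>labels S. pos 0 S a = pos 0 T a \<and> (\<forall>b. above S b a \<longrightarrow> above T b a)"
      by (rule stuck_agrees[where U = S and V = "[]", OF S T le]) (use no_raise no_exchange in auto)
    have "S = T"
      by (rule shade_eqI[of _ _ 0])
        (use S T P agree above_labels[of S] in \<open>auto simp: unary_shades_iff\<close>)
    with \<open>S \<noteq> T\<close> show False ..
  qed
qed

section \<open>Shades with prescribed data\<close>

text \<open>Built from the top: if some label has coordinate \<open>k\<close>, the first label in
  the order \<open>R\<close> becomes a cut; otherwise a tuple leads to the next element of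
  \<open>P\<close>. Each choice shrinks \<open>A\<close> or \<open>P\<close>, until no label is left
  and \<open>P = {k}\<close>.\<close>

lemma exists_shade:
  fixes P A :: "nat set" and R :: "nat \<Rightarrow> nat \<Rightarrow> bool"
  assumes "finite A" "finite P" "k \<in> P" "\<forall>x\<in>P. k \<le> x" "p ` A \<subseteq> P"
    and "transp_on A R" "asymp_on A R" "totalp_on A R"
    and "\<forall>a\<in>A. \<forall>b\<in>A. R a b \<longrightarrow> p a \<le> p b"
  shows "\<exists>S. unary_items S \<and> disjoint_labels S \<and> labels S = A \<and> prefix_sums k S = P \<and>
    (\<forall>a\<in>A. pos k S a = p a) \<and> (\<forall>a\<in>A. \<forall>b\<in>A. above S a b \<longleftrightarrow> R a b)"
  using assms
proof (induction "card A + card P" arbitrary: A P k rule: less_induct)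
  case less
  show ?case
  proof (cases "\<exists>a\<in>A. p a = k")
    case True
    then have "A \<noteq> {}" by blast
    then obtain a where a: "a \<in> A" "\<forall>x\<in>A. x \<noteq> a \<longrightarrow> \<not> R x a"
      using Finite_Set.bex_min_element[of A R] less.prems by blast
    then have min: "\<forall>x\<in>A. x \<noteq> a \<longrightarrow> R a x"
      using less.prems(8) by (auto simp: totalp_on_def)
    \<comment> \<open>The first label also has coordinate \<open>k\<close>: monotonicity gives
      \<open>p a \<le> p a0\<close>, and \<open>k\<close> is least in \<open>P\<close>.\<close>
    obtain a0 where "a0 \<in> A" "p a0 = k"
      using True by blast
    then have "p a = k"
      using min a(1) less.prems by (metis image_subset_iff le_antisym)
    have "\<exists>S. unary_items S \<and> disjoint_labels S \<and> labels S = A - {a} \<and> prefix_sums k S = P \<and>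
      (\<forall>b\<in>A - {a}. pos k S b = p b) \<and> (\<forall>b\<in>A - {a}. \<forall>c\<in>A - {a}. above S b c \<longleftrightarrow> R b c)"
    proof (rule less.hyps)
      show "card (A - {a}) + card P < card A + card P"
        using card_Diff1_less[OF less.prems(1) a(1)] by simp
    qed (use less.prems in \<open>auto intro: transp_on_subset asymp_on_subset totalp_on_subset\<close>)
    then obtain S where S: "unary_items S" "disjoint_labels S" "labels S = A - {a}"
      "prefix_sums k S = P" "\<forall>b\<in>A - {a}. pos k S b = p b"
      "\<forall>b\<in>A - {a}. \<forall>c\<in>A - {a}. above S b c \<longleftrightarrow> R b c"
      by blast
    have "\<not> R a a"
      using less.prems(7) a(1) by (meson asymp_onD)
    then have "above (([], {a}) # S) b c \<longleftrightarrow> R b c" if "b \<in> A" "c \<in> A" for b c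
      using that S(3,6) a min above_labels[of S b c] by auto
    then have "unary_items (([], {a}) # S) \<and> disjoint_labels (([], {a}) # S) \<and>
        labels (([], {a}) # S) = A \<and> prefix_sums k (([], {a}) # S) = P \<and>
        (\<forall>b\<in>A. pos k (([], {a}) # S) b = p b) \<and>
        (\<forall>b\<in>A. \<forall>c\<in>A. above (([], {a}) # S) b c \<longleftrightarrow> R b c)"
      using S a(1) \<open>p a = k\<close> less.prems(3) by auto
    then show ?thesis by (rule exI)
  next
    case no_label: False
    show ?thesis
    proof (cases "P = {k}")
      case True
      then show ?thesis
        using no_label less.prems(5) by (intro exI[of _ "[]"]) auto
    next
      case False
      \<comment> \<open>The gap from \<open>k\<close> to the next prefix sum \<open>k'\<close> is
        the entry of the new tuple.\<close>
      define k' where "k' = Min (P - {k})"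
      have "P - {k} \<noteq> {}"
        using False less.prems(3) by blast
      then have k': "k' \<in> P - {k}" "\<forall>x\<in>P - {k}. k' \<le> x"
        using less.prems(2) Min_in[of "P - {k}"] by (auto simp: k'_def)
      then have "k < k'"
        using less.prems(4) by (simp add: le_neq_implies_less)
      have "\<exists>S. unary_items S \<and> disjoint_labels S \<and> labels S = A \<and> prefix_sums k' S = P - {k} \<and>
        (\<forall>a\<in>A. pos k' S a = p a) \<and> (\<forall>a\<in>A. \<forall>b\<in>A. above S a b \<longleftrightarrow> R a b)"
      proof (rule less.hyps)
        show "card A + card (P - {k}) < card A + card P"
          using card_Diff1_less[OF less.prems(2,3)] by simp
      qed (use less.prems no_label k' in auto)
      then obtain S where S: "unary_items S" "disjoint_labels S" "labels S = A"
        "prefix_sums k' S = P - {k}" "\<forall>a\<in>A. pos k' S a = p a"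
        "\<forall>a\<in>A. \<forall>b\<in>A. above S a b \<longleftrightarrow> R a b"
        by blast
      then show ?thesis
        using \<open>k < k'\<close> less.prems(3) by (intro exI[of _ "([k' - k], {}) # S"]) auto
    qed
  qed
qed

text \<open>Joins and the bottom are obtained from this by specifying their data. The weight is
  \<open>n\<close> because the total is the largest prefix sum.\<close>

lemma exists_unary_shade:
  fixes P :: "nat set" and R :: "nat \<Rightarrow> nat \<Rightarrow> bool"
  assumes "0 \<in> P" "n \<in> P" "P \<subseteq> {..n}" "p ` {1..m} \<subseteq> P"
    and "transp_on {1..m} R" "asymp_on {1..m} R" "totalp_on {1..m} R"
    and "\<And>a b. a \<in> {1..m} \<Longrightarrow> b \<in> {1..m} \<Longrightarrow> R a b \<Longrightarrow> p a \<le> p b"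
  obtains S where "S \<in> unary_shades m n" "prefix_sums 0 S = P"
    "\<And>a. a \<in> {1..m} \<Longrightarrow> pos 0 S a = p a"
    "\<And>a b. a \<in> {1..m} \<Longrightarrow> b \<in> {1..m} \<Longrightarrow> above S a b \<longleftrightarrow> R a b"
proof -
  have "finite P"
    using assms(3) finite_subset by blast
  then obtain S where S: "unary_items S" "disjoint_labels S" "labels S = {1..m}"
    "prefix_sums 0 S = P" "\<forall>a\<in>{1..m}. pos 0 S a = p a"
    "\<forall>a\<in>{1..m}. \<forall>b\<in>{1..m}. above S a b \<longleftrightarrow> R a b"
    using exists_shade[of "{1..m}" P 0 p R] assms by auto
  have "weight S = n"
    using prefix_sums_end[of 0 S] prefix_sums_bounds[of n 0 S] S(4) assms(2,3) by auto
  then show thesis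
    using S by (intro that[of S]) (auto simp: unary_shades_iff)
qed

section \<open>Joins\<close>

text \<open>The property says that, on increasing triples, the complement of \<open>G\<close> is
  transitive. A chain from \<open>a\<close> to \<open>c\<close> either visits \<open>b\<close> or
  has a step jumping over it; one half of that step, joined to the chain on its side, connects
  \<open>b\<close> to an end.\<close>

lemma trancl_between:
  fixes G :: "nat rel"
  assumes between: "\<And>a b c. (a, c) \<in> G \<Longrightarrow> a < b \<Longrightarrow> b < c \<Longrightarrow> (a, b) \<in> G \<or> (b, c) \<in> G"
    and "(a, c) \<in> G\<^sup>+" "a < b" "b < c"
  shows "(a, b) \<in> G\<^sup>+ \<or> (b, c) \<in> G\<^sup>+"
  using assms(2-)
proof (induction rule: trancl_induct)
  case (base c)
  then show ?case using between by blast
next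
  case (step c d)
  consider "b < c" | "b = c" | "c < b" by linarith
  then show ?case
  proof cases
    case 1
    then show ?thesis using step by (meson trancl.trancl_into_trancl)
  next
    case 2
    then show ?thesis using step by blast
  next
    case 3
    then show ?thesis using between[OF step.hyps(2)] step by (meson r_into_trancl' trancl.trancl_into_trancl)
  qed
qed

text \<open>The noninversions of the join are the transitive closure \<open>H\<close> of the union of the
  noninversions, as for the weak order. The coordinate of a label is the least one that is
  forced on it by the labels which \<open>H\<close> puts below it.\<close>

lemma exists_join:
  assumes S: "S \<in> unary_shades m n" and T: "T \<in> unary_shades m n"
  obtains J where "J \<in> unary_shades m n" "shade_le S J" "shade_le T J"
    "\<And>Z. Z \<in> unary_shades m n \<Longrightarrow> shade_le S Z \<Longrightarrow> shade_le T Z \<Longrightarrow> shade_le J Z"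
proof -
  have labels: "labels S = {1..m}" "labels T = {1..m}"
    using S T by (auto simp: unary_shades_iff)
  define G where "G = {(a, b). a < b \<and> (above S a b \<or> above T a b)}"
  define H where "H = G\<^sup>+"
  \<comment> \<open>If \<open>b\<close> were above \<open>a\<close>, transitivity would put
    \<open>b\<close> above \<open>c\<close>.\<close>
  have between_above: "above X a b \<or> above X b c"
    if "X \<in> unary_shades m n" "above X a c" "a < b" "b < c" for X a b c
  proof -
    have X: "unary_items X" "disjoint_labels X" "labels X = {1..m}"
      using that by (auto simp: unary_shades_iff)
    then have "a \<in> labels X" "b \<in> labels X"
      using above_labels[OF that(2)] that(3,4) by auto
    then show ?thesis
      using X that above_total[of X a b] above_trans[of X b a c] by blast
  qed
  have G_labels: "a < b \<and> a \<in> {1..m} \<and> b \<in> {1..m}" if "(a, b) \<in> G" for a b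
    using that above_labels[of S a b] above_labels[of T a b] labels by (auto simp: G_def)
  have H_labels: "a < b \<and> a \<in> {1..m} \<and> b \<in> {1..m}" if "(a, b) \<in> H" for a b
    using that unfolding H_def
    by (induction rule: trancl_induct) (use G_labels less_trans in blast)+
  have H_trans: "(a, b) \<in> H \<Longrightarrow> (b, c) \<in> H \<Longrightarrow> (a, c) \<in> H" for a b c
    unfolding H_def by (rule trancl_trans)
  have "(a, b) \<in> G \<or> (b, c) \<in> G" if "(a, c) \<in> G" "a < b" "b < c" for a b c
    using that between_above[OF S, of a c b] between_above[OF T, of a c b] by (auto simp: G_def)
  then have H_between: "(a, b) \<in> H \<or> (b, c) \<in> H" if "(a, c) \<in> H" "a < b" "b < c" for a b c
    using that trancl_between[of G] unfolding H_def by blast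
  \<comment> \<open>Pairs in \<open>H\<close> keep their natural order and all others are inverted.
    Both \<open>H\<close> and its complement among increasing pairs are transitive, which makes
    \<open>R\<close> a strict total order.\<close>
  define R where "R a b \<longleftrightarrow> (a, b) \<in> H \<or> b < a \<and> (b, a) \<notin> H" for a b
  have R_trans: "R a c" if R: "R a b" "R b c" for a b c
  proof -
    consider "(a, b) \<in> H" "(b, c) \<in> H" | "(a, b) \<in> H" "c < b" "(c, b) \<notin> H"
      | "b < a" "(b, a) \<notin> H" "(b, c) \<in> H" | "b < a" "(b, a) \<notin> H" "c < b" "(c, b) \<notin> H"
      using R unfolding R_def by blast
    then show ?thesis
    proof cases
      case 1
      then show ?thesis using H_trans R_def by blast
    next
      case 2
      \<comment> \<open>\<open>H_trans\<close> rules out \<open>(c, a)\<close>, which settles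
        \<open>c < a\<close>; for \<open>a < c\<close>, \<open>H_between\<close> gives
        \<open>(a, c)\<close>. The other mixed case is alike.\<close>
      then have "a \<noteq> c" "(c, a) \<notin> H" using H_trans by blast+
      then show ?thesis
        using 2 H_between[of a b c] unfolding R_def by (metis linorder_neqE_nat)
    next
      case 3
      then have "a \<noteq> c" "(c, a) \<notin> H" using H_trans by blast+
      then show ?thesis
        using 3 H_between[of b c a] unfolding R_def by (metis linorder_neqE_nat)
    next
      case 4
      then have "c < a" by simp
      then show ?thesis using 4 H_between[of c a b] unfolding R_def by blast
    qed
  qed
  \<comment> \<open>In any common upper bound the coordinate of \<open>c\<close> is at most
    \<open>q c\<close>. Every label above \<open>c\<close> inherits this bound, hence the minimum in
    \<open>p\<close>.\<close>
  define q where "q c = min (pos 0 S c) (pos 0 T c)" for c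
  define p where "p a = Min (q ` {c. a = c \<or> (a, c) \<in> H})" for a
  have fin: "finite {c. a = c \<or> (a, c) \<in> H}" for a
    by (rule finite_subset[of _ "insert a {1..m}"]) (use H_labels in auto)
  have p_le: "p a \<le> q c" if "a = c \<or> (a, c) \<in> H" for a c
    unfolding p_def using fin[of a] that by (intro Min_le) auto
  have p_attained: "\<exists>c. (a = c \<or> (a, c) \<in> H) \<and> p a = q c" for a
    using Min_in[of "q ` {c. a = c \<or> (a, c) \<in> H}"] fin[of a] unfolding p_def by blast
  have p_mono: "p a \<le> p b" if "R a b" "a \<in> {1..m}" "b \<in> {1..m}" for a b
  proof -
    obtain c where c: "b = c \<or> (b, c) \<in> H" "p b = q c"
      using p_attained by blast
    then have "c \<in> {1..m}"
      using H_labels that by blast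
    show ?thesis
    proof (cases "a = c \<or> (a, c) \<in> H")
      case True
      then show ?thesis using p_le c(2) by simp
    next
      case False
      \<comment> \<open>If \<open>c\<close>, which attains \<open>p b\<close>, is neither
        \<open>a\<close> nor put below \<open>a\<close> by \<open>H\<close>, then
        \<open>c < a\<close> and both shades have \<open>a\<close> above \<open>c\<close>. Hence
        \<open>p a \<le> q a \<le> q c\<close>.\<close>
      then have ba: "b < a" "(b, a) \<notin> H"
        using that(1) c(1) H_trans unfolding R_def by blast+
      then have "c < a"
        using False c(1) H_between[of b c a] by (metis linorder_neqE_nat)
      moreover have "(c, a) \<notin> G"
        using ba c(1) H_trans[of b c a] unfolding H_def by blast
      ultimately have "\<not> above S c a" "\<not> above T c a"
        by (auto simp: G_def)
      then have "above S a c" "above T a c"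
        using above_total[of S a c] above_total[of T a c] S T labels that \<open>c \<in> {1..m}\<close> \<open>c < a\<close>
        by (auto simp: unary_shades_iff)
      then have "q a \<le> q c"
        using S T pos_mono[of S a c 0] pos_mono[of T a c 0] unfolding q_def unary_shades_iff
        by (meson min.mono)
      then show ?thesis using p_le[of a a] c(2) by simp
    qed
  qed
  obtain J where J: "J \<in> unary_shades m n" "prefix_sums 0 J = prefix_sums 0 S \<union> prefix_sums 0 T"
    "\<And>a. a \<in> {1..m} \<Longrightarrow> pos 0 J a = p a"
    "\<And>a b. a \<in> {1..m} \<Longrightarrow> b \<in> {1..m} \<Longrightarrow> above J a b \<longleftrightarrow> R a b"
  proof (rule exists_unary_shade[of "prefix_sums 0 S \<union> prefix_sums 0 T" n p m R])
    show "n \<in> prefix_sums 0 S \<union> prefix_sums 0 T"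
      using prefix_sums_end[of 0 S] S by (simp add: unary_shades_iff)
    show "prefix_sums 0 S \<union> prefix_sums 0 T \<subseteq> {..n}"
      using S T by (auto simp: unary_shades_iff dest: prefix_sums_bounds)
    show "p ` {1..m} \<subseteq> prefix_sums 0 S \<union> prefix_sums 0 T"
    proof
      fix x assume "x \<in> p ` {1..m}"
      then obtain a where "a \<in> {1..m}" "x = p a" by blast
      then obtain c where "c \<in> {1..m}" "x = q c"
        using p_attained[of a] H_labels by metis
      then show "x \<in> prefix_sums 0 S \<union> prefix_sums 0 T"
        using pos_prefix_sums[of c S 0] pos_prefix_sums[of c T 0] labels
        by (auto simp: q_def min_def)
    qed
    show "transp_on {1..m} R"
      using R_trans by (blast intro: transp_onI)
    show "asymp_on {1..m} R"
      unfolding asymp_on_def R_def using H_labels less_asym by metis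
    show "totalp_on {1..m} R"
      by (intro totalp_onI) (auto simp: R_def)
  qed (use p_mono in auto)
  have labelsJ: "labels J = {1..m}"
    using J(1) by (simp add: unary_shades_iff)
  have above_J: "above J a b \<longleftrightarrow> (a, b) \<in> H" if "a < b" for a b
    using J(4)[of a b] H_labels[of a b] above_labels[of J a b] labelsJ that
    unfolding R_def by auto
  show thesis
  proof (rule that[OF J(1)])
    have "p a \<le> pos 0 S a" "p a \<le> pos 0 T a" for a
      using p_le[of a a] by (auto simp: q_def)
    moreover have "a < b \<Longrightarrow> above S a b \<or> above T a b \<Longrightarrow> (a, b) \<in> H" for a b
      unfolding H_def G_def by blast
    ultimately show "shade_le S J" "shade_le T J"
      using J(2,3) above_J labels by (auto simp: shade_le_def)
    fix Z assume Z: "Z \<in> unary_shades m n" and le: "shade_le S Z" "shade_le T Z"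
    then have dZ: "disjoint_labels Z" by (simp add: unary_shades_iff)
    have above_Z: "above Z a b" if "(a, b) \<in> H" for a b
      using that unfolding H_def
    proof (induction rule: trancl_induct)
      case (base b)
      then show ?case using le by (auto simp: G_def shade_le_def)
    next
      case (step b c)
      then have "above Z b c" using le by (auto simp: G_def shade_le_def)
      then show ?case using step above_trans[OF dZ] by blast
    qed
    \<comment> \<open>\<open>p a\<close> is \<open>q c\<close> for \<open>c\<close> equal to
      \<open>a\<close> or put below it by \<open>H\<close>; \<open>Z\<close> respects both the bound
      \<open>q c\<close> and the order.\<close>
    have "pos 0 Z a \<le> p a" if a: "a \<in> {1..m}" for a
    proof -
      obtain c where c: "a = c \<or> (a, c) \<in> H" "p a = q c"
        using p_attained by blast
      then have "c \<in> {1..m}"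
        using H_labels a by blast
      then have "pos 0 Z c \<le> q c"
        using le labels by (auto simp: shade_le_def q_def)
      moreover have "pos 0 Z a \<le> pos 0 Z c"
        using c(1) above_Z pos_mono[OF dZ] by blast
      ultimately show ?thesis using c(2) by simp
    qed
    then show "shade_le J Z"
      using le J(2,3) above_J above_Z labelsJ by (auto simp: shade_le_def)
  qed
qed

section \<open>Bottom element and meets\<close>

text \<open>The bottom is the tuple \<open>(n)\<close>, absent if \<open>n = 0\<close>, above all
  cuts in decreasing order of labels: fewest prefix sums, lowest cuts, no noninversions.\<close>

lemma exists_bottom:
  obtains B where "B \<in> unary_shades m n" "\<And>Z. Z \<in> unary_shades m n \<Longrightarrow> shade_le B Z"
proof -
  obtain B where B: "B \<in> unary_shades m n" "prefix_sums 0 B = {0, n}"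
    "\<And>a. a \<in> {1..m} \<Longrightarrow> pos 0 B a = n"
    "\<And>a b. a \<in> {1..m} \<Longrightarrow> b \<in> {1..m} \<Longrightarrow> above B a b \<longleftrightarrow> a > b"
    by (rule exists_unary_shade[of "{0, n}" n "\<lambda>_. n" m "(>)"])
      (auto simp: transp_on_def asymp_on_def totalp_on_def)
  have "shade_le B Z" if Z: "Z \<in> unary_shades m n" for Z
    unfolding shade_le_def
  proof (intro conjI ballI allI impI)
    show "prefix_sums 0 B \<subseteq> prefix_sums 0 Z"
      using B(2) prefix_sums_end[of 0 Z] Z by (auto simp: unary_shades_iff)
    show "pos 0 Z a \<le> pos 0 B a" if "a \<in> labels B" for a
      using that B(1,3) Z pos_bounds[of a Z 0] by (auto simp: unary_shades_iff)
    show "above Z a b" if "a < b" "above B a b" for a b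
      using that B(1,4) above_labels[of B a b] by (auto simp: unary_shades_iff)
  qed
  then show thesis using that B(1) by blast
qed

text \<open>In a finite poset with binary joins and a least element, a maximal common lower bound
  is the greatest one.\<close>

lemma exists_meet:
  assumes S: "S \<in> unary_shades m n" and T: "T \<in> unary_shades m n"
  obtains M where "M \<in> unary_shades m n" "shade_le M S" "shade_le M T"
    "\<And>Z. Z \<in> unary_shades m n \<Longrightarrow> shade_le Z S \<Longrightarrow> shade_le Z T \<Longrightarrow> shade_le Z M"
proof -
  define A where "A = {Z \<in> unary_shades m n. shade_le Z S \<and> shade_le Z T}"
  let ?less = "\<lambda>X Y. X \<noteq> Y \<and> shade_le X Y"
  have trans: "shade_le X Z"
    if "X \<in> unary_shades m n" "Y \<in> unary_shades m n" "shade_le X Y" "shade_le Y Z" for X Y Z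
    using that by (intro shade_le_trans[of X Y Z]) (auto simp: unary_shades_iff)
  have "finite A"
    unfolding A_def using unary_shades_finite by simp
  moreover have "A \<noteq> {}"
  proof -
    obtain B where "B \<in> unary_shades m n" "\<And>Z. Z \<in> unary_shades m n \<Longrightarrow> shade_le B Z"
      by (rule exists_bottom[of m n]) blast
    then have "B \<in> A"
      using S T by (simp add: A_def)
    then show ?thesis by blast
  qed
  moreover have "asymp_on A ?less"
    by (rule asymp_onI) (auto simp: A_def dest: shade_le_antisym)
  moreover have "transp_on A ?less"
  proof (rule transp_onI)
    fix X Y Z
    assume "X \<in> A" "Y \<in> A" "Z \<in> A" "?less X Y" "?less Y Z"
    then show "?less X Z"
      using trans[of X Y Z] shade_le_antisym[of X m n Y] by (auto simp: A_def)
  qed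
  ultimately obtain M where M: "M \<in> A" "\<forall>Z\<in>A. Z \<noteq> M \<longrightarrow> \<not> ?less M Z"
    using Finite_Set.bex_max_element[of A ?less] by auto
  have "shade_le Z M" if "Z \<in> A" for Z
  proof -
    have in_carrier: "Z \<in> unary_shades m n" "M \<in> unary_shades m n"
      using \<open>Z \<in> A\<close> M(1) by (auto simp: A_def)
    obtain J where J: "J \<in> unary_shades m n" "shade_le Z J" "shade_le M J"
      "\<And>Y. Y \<in> unary_shades m n \<Longrightarrow> shade_le Z Y \<Longrightarrow> shade_le M Y \<Longrightarrow> shade_le J Y"
      by (rule exists_join[OF in_carrier]) blast
    \<comment> \<open>\<open>S\<close> and \<open>T\<close> are upper bounds of \<open>Z\<close> and
      \<open>M\<close>, hence of their join; maximality of \<open>M\<close> then forces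
      \<open>J = M\<close>.\<close>
    have "J \<in> A"
      using S T \<open>Z \<in> A\<close> M(1) J(1,4) by (simp add: A_def)
    then show ?thesis
      using M(2) J(2,3) by auto
  qed
  then show thesis
    using M(1) by (intro that[of M]) (auto simp: A_def)
qed

section \<open>The lattice and its covering relation\<close>

theorem proposition27:
  fixes m n :: nat
  shows "\<exists>L :: shade gorder. lattice L \<and>
           is_Hasse_diagram (unary_shades m n) (right_rotation_edges m n) L"
proof -
  let ?L = "\<lparr>carrier = unary_shades m n, eq = (=), le = shade_le\<rparr> :: shade gorder"
  have "partial_order ?L"
  proof unfold_locales
    fix X Y Z
    assume "X \<sqsubseteq>\<^bsub>?L\<^esub> Y" "Y \<sqsubseteq>\<^bsub>?L\<^esub> Z" "X \<in> carrier ?L" "Y \<in> carrier ?L" "Z \<in> carrier ?L"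
    then show "X \<sqsubseteq>\<^bsub>?L\<^esub> Z"
      using shade_le_trans[of X Y Z] by (simp add: unary_shades_iff)
  qed (auto simp: shade_le_refl intro: shade_le_antisym)
  then interpret partial_order ?L .
  have "lattice ?L"
  proof unfold_locales
    fix X Y assume "X \<in> carrier ?L" "Y \<in> carrier ?L"
    then have XY: "X \<in> unary_shades m n" "Y \<in> unary_shades m n" by simp_all
    show "\<exists>s. least ?L s (Upper ?L {X, Y})"
      by (rule exists_join[OF XY]) (rule exI, rule least_UpperI, use XY in \<open>auto simp: Upper_def\<close>)
    show "\<exists>s. greatest ?L s (Lower ?L {X, Y})"
      by (rule exists_meet[OF XY]) (rule exI, rule greatest_LowerI, use XY in \<open>auto simp: Lower_def\<close>)
  qed
  moreover have "(S, S') \<in> right_rotation_edges m n \<longleftrightarrow> covered_by ?L S S'" for S S'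
  proof
    assume "(S, S') \<in> right_rotation_edges m n"
    then have S: "S \<in> unary_shades m n" "S' \<in> unary_shades m n" and rot: "right_rotation S S'"
      by (auto simp: right_rotation_edges_def)
    show "covered_by ?L S S'"
      using S right_rotation_le[OF rot S(1)] right_rotation_no_between[OF rot S]
      by (auto simp: covered_by_def lless_def)
  next
    assume "covered_by ?L S S'"
    then have S: "S \<in> unary_shades m n" "S' \<in> unary_shades m n" "shade_le S S'" "S \<noteq> S'"
      and no_between: "\<And>Z. Z \<in> unary_shades m n \<Longrightarrow> shade_le S Z \<Longrightarrow> S \<noteq> Z \<Longrightarrow>
        shade_le Z S' \<Longrightarrow> Z = S'"
      by (auto simp: covered_by_def lless_def)
    \<comment> \<open>A rotation of \<open>S\<close> that stays below \<open>S'\<close> is strictly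
      above \<open>S\<close>, so if \<open>S'\<close> covers \<open>S\<close> it can only be
      \<open>S'\<close>.\<close>
    obtain Z where Z: "Z \<in> unary_shades m n" "right_rotation S Z" "shade_le Z S'"
      using exists_right_rotation[OF S] by (elim bexE conjE)
    then have "Z = S'"
      using no_between[OF Z(1) _ _ Z(3)] right_rotation_le[OF Z(2) S(1)] by simp
    then show "(S, S') \<in> right_rotation_edges m n"
      using S Z by (simp add: right_rotation_edges_def)
  qed
  then have "is_Hasse_diagram (unary_shades m n) (right_rotation_edges m n) ?L"
    by (auto simp: is_Hasse_diagram_def)
  ultimately show ?thesis by blast
qed

end
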